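(* Let $\mu,\nu\in\mathcal P(\mathbb R^N)$ have finite supports $S_\mu:=\operatorname{supp}(\mu)$, $S_\nu:=\operatorname{supp}(\nu)$, and let $c:\mathbb R^N\times\mathbb R^N\to\mathbb R$ be continuous. The optimization problem $\min_{\pi\in\Pi_c(\mu,\nu)}\int c\,d\pi$ is (under the identification of $\pi$ with its weights $\pi_{x,y}=\pi(\{(x,y)\})$, $x\in S_\mu$, $y\in S_\nu$) the linear program $$\min_{(\pi_{x,y})_{x\in S_\mu,y\in S_\nu}}\ \sum_{x\in S_\mu,\,y\in S_\nu}c(x,y)\,\pi_{x,y}$$ subject to $\pi_{x,y}\in[0,1]$ for $x\in S_\mu$, $y\in S_\nu$; $\sum_{x\in S_\mu}\pi_{x,y}=\nu(y)$ for $y\in S_\nu$; $\sum_{y\in S_\nu}\pi_{x,y}=\mu(x)$ for $x\in S_\mu$; and $$\Big(\sum_{\tilde x\in S_\mu:\,\tilde x_{1:t}=x_{1:t}^{(i)}}\mu(\tilde x)\Big)\Big(\sum_{\substack{\tilde x\in S_\mu:\ \tilde x_{1:t}=x_{1:t}^{(i)},\\ \tilde x_{t+1}=x_{t+1}^{(k)}}}\ \sum_{\tilde y\in S_\nu:\,\tilde y_{1:t}=y_{1:t}^{(j)}}\pi_{\tilde x,\tilde y}\Big)=\Big(\sum_{\substack{\tilde x\in S_\mu:\ \tilde x_{1:t}=x_{1:t}^{(i)},\\ \tilde x_{t+1}=x_{t+1}^{(k)}}}\mu(\tilde x)\Big)\Big(\sum_{\tilde x\in S_\mu:\,\tilde x_{1:t}=x_{1:t}^{(i)}}\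 \sum_{\tilde y\in S_\nu:\,\tilde y_{1:t}=y_{1:t}^{(j)}}\pi_{\tilde x,\tilde y}\Big)$$ for all $k\in[n_{t+1}]$, $j\in[m_{1:t}]$, $i\in[n_{1:t}]$, $t\in[N-1]$.
   Context: Here $\mathcal X=\mathcal Y=\mathbb R^N$ with time-$t$ coordinates in $\mathbb R$. $[n]=\{1,\dots,n\}$, $\mu(x):=\mu(\{x\})$, $\nu(y):=\nu(\{y\})$; for $x\in\mathbb R^N$, $x_{1:t}$ denotes the first $t$ entries and $x_t$ the $t$-th entry, similarly for $y$. For each $t$, $x_{1:t}^{(1)},\dots,x_{1:t}^{(n_{1:t})}$ is an enumeration of $\{x_{1:t}:x\in S_\mu\}$, $x_t^{(1)},\dots,x_t^{(n_t)}$ an enumeration of $\{x_t:x\in S_\mu\}$, and $y_{1:t}^{(1)},\dots,y_{1:t}^{(m_{1:t})}$ an enumeration of $\{y_{1:t}:y\in S_\nu\}$. With $X_t,Y_t$ the coordinate projections and $X_{1:t}=(X_1,\dots,X_t)$ etc., $\Pi_c(\mu,\nu)$ is the set of couplings $\pi$ of $\mu$ and $\nu$ which are causal: under $\pi$, for all $t=1,\dots,N-1$, $X_{t+1}$ is conditionally independent of $Y_{1:t}$ given $X_{1:t}$. *)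

theory Defs
  imports "HOL-Probability.Probability"
begin

text \<open>Points of \<open>\<real>\<^sup>N\<close> are functions \<open>nat \<Rightarrow> real\<close> that are \<open>undefined\<close> outside \<open>{1..N}\<close>.
  For \<open>t \<le> N\<close>, the initial segment \<open>x\<^bsub>1:t\<^esub>\<close> is \<open>restrict x {1..t}\<close>, a point of \<open>\<real>\<^sup>t\<close>.\<close>

definition path_space :: "nat \<Rightarrow> (nat \<Rightarrow> real) measure" where
  "path_space N = (\<Pi>\<^sub>M t\<in>{1..N}. borel)"

definition path_topology :: "nat \<Rightarrow> (nat \<Rightarrow> real) topology" where
  "path_topology N = product_topology (\<lambda>_. euclideanreal) {1..N}"

definition supp :: "nat \<Rightarrow> (nat \<Rightarrow> real) measure \<Rightarrow> (nat \<Rightarrow> real) set" where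
  "supp N \<mu> = {x \<in> topspace (path_topology N).
     \<forall>U. openin (path_topology N) U \<and> x \<in> U \<longrightarrow> measure \<mu> U > 0}"

text \<open>\<open>X\<close> and \<open>Y\<close> are conditionally independent given \<open>Z\<close> under \<open>M\<close>:
  \<open>P(X \<in> A, Y \<in> B | Z) = P(X \<in> A | Z) P(Y \<in> B | Z)\<close> almost surely for all measurable \<open>A\<close>, \<open>B\<close>.\<close>

definition cond_indep_given ::
  "'a measure \<Rightarrow> 'b measure \<Rightarrow> ('a \<Rightarrow> 'b) \<Rightarrow> 'c measure \<Rightarrow> ('a \<Rightarrow> 'c) \<Rightarrow> 'd measure \<Rightarrow> ('a \<Rightarrow> 'd) \<Rightarrow> bool"
where
  "cond_indep_given M MX X MY Y MZ Z \<longleftrightarrow>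
     X \<in> measurable M MX \<and> Y \<in> measurable M MY \<and> Z \<in> measurable M MZ \<and>
     (\<forall>A\<in>sets MX. \<forall>B\<in>sets MY.
       AE \<omega> in M.
         real_cond_exp M (vimage_algebra (space M) Z MZ)
           (\<lambda>\<omega>. indicator A (X \<omega>) * indicator B (Y \<omega>)) \<omega>
       = real_cond_exp M (vimage_algebra (space M) Z MZ) (\<lambda>\<omega>. indicator A (X \<omega>)) \<omega>
       * real_cond_exp M (vimage_algebra (space M) Z MZ) (\<lambda>\<omega>. indicator B (Y \<omega>)) \<omega>)"

definition couplings ::
  "nat \<Rightarrow> (nat \<Rightarrow> real) measure \<Rightarrow> (nat \<Rightarrow> real) measure
    \<Rightarrow> ((nat \<Rightarrow> real) \<times> (nat \<Rightarrow> real)) measure set"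
where
  "couplings N \<mu> \<nu> =
     {\<pi> \<in> space (prob_algebra (path_space N \<Otimes>\<^sub>M path_space N)).
        distr \<pi> (path_space N) fst = \<mu> \<and> distr \<pi> (path_space N) snd = \<nu>}"

definition causal_couplings ::
  "nat \<Rightarrow> (nat \<Rightarrow> real) measure \<Rightarrow> (nat \<Rightarrow> real) measure
    \<Rightarrow> ((nat \<Rightarrow> real) \<times> (nat \<Rightarrow> real)) measure set"
where
  "causal_couplings N \<mu> \<nu> =
     {\<pi> \<in> couplings N \<mu> \<nu>. \<forall>t\<in>{1..N-1}.
        cond_indep_given \<pi>
          borel (\<lambda>(x, y). x (t + 1))
          (path_space t) (\<lambda>(x, y). restrict y {1..t})
          (path_space t) (\<lambda>(x, y). restrict x {1..t})}"

text \<open>The weights \<open>\<pi>\<^bsub>x,y\<^esub>\<close>, indexed by \<open>(x, y) \<in> S \<times> T\<close>; as elements of \<open>extensional (S \<times> T)\<close> they carry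
  no information outside the index set.\<close>

definition weights ::
  "'a set \<Rightarrow> 'b set \<Rightarrow> ('a \<times> 'b) measure \<Rightarrow> 'a \<times> 'b \<Rightarrow> real"
where
  "weights S T \<pi> = restrict (\<lambda>z. measure \<pi> {z}) (S \<times> T)"

definition lp_objective ::
  "'a set \<Rightarrow> 'b set \<Rightarrow> ('a \<times> 'b \<Rightarrow> real) \<Rightarrow> ('a \<times> 'b \<Rightarrow> real) \<Rightarrow> real"
where
  "lp_objective S T c w = (\<Sum>x\<in>S. \<Sum>y\<in>T. c (x, y) * w (x, y))"

text \<open>Feasible points of the linear program. \<open>xpre t i\<close> for \<open>i \<in> {1..nxpre t}\<close> stands for
  \<open>x\<^bsub>1:t\<^esub>\<^bsup>(i)\<^esup>\<close>, \<open>xcur t k\<close> for \<open>k \<in> {1..nxcur t}\<close> for \<open>x\<^bsub>t\<^esub>\<^bsup>(k)\<^esup>\<close>,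
  and \<open>ypre t j\<close> for \<open>j \<in> {1..mypre t}\<close> for \<open>y\<^bsub>1:t\<^esub>\<^bsup>(j)\<^esup>\<close>.\<close>

definition lp_feasible ::
  "nat \<Rightarrow> (nat \<Rightarrow> real) measure \<Rightarrow> (nat \<Rightarrow> real) measure
    \<Rightarrow> (nat \<Rightarrow> nat) \<Rightarrow> (nat \<Rightarrow> nat \<Rightarrow> nat \<Rightarrow> real)
    \<Rightarrow> (nat \<Rightarrow> nat) \<Rightarrow> (nat \<Rightarrow> nat \<Rightarrow> real)
    \<Rightarrow> (nat \<Rightarrow> nat) \<Rightarrow> (nat \<Rightarrow> nat \<Rightarrow> nat \<Rightarrow> real)
    \<Rightarrow> ((nat \<Rightarrow> real) \<times> (nat \<Rightarrow> real) \<Rightarrow> real) set"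
where
  "lp_feasible N \<mu> \<nu> nxpre xpre nxcur xcur mypre ypre =
    (let S = supp N \<mu>; T = supp N \<nu> in
     {w \<in> extensional (S \<times> T).
        (\<forall>x\<in>S. \<forall>y\<in>T. w (x, y) \<in> {0..1}) \<and>
        (\<forall>y\<in>T. (\<Sum>x\<in>S. w (x, y)) = measure \<nu> {y}) \<and>
        (\<forall>x\<in>S. (\<Sum>y\<in>T. w (x, y)) = measure \<mu> {x}) \<and>
        (\<forall>t\<in>{1..N-1}. \<forall>i\<in>{1..nxpre t}. \<forall>j\<in>{1..mypre t}. \<forall>k\<in>{1..nxcur (t + 1)}.
           (\<Sum>x | x \<in> S \<and> restrict x {1..t} = xpre t i. measure \<mu> {x})
           * (\<Sum>x | x \<in> S \<and> restrict x {1..t} = xpre t i \<and> x (t + 1) = xcur (t + 1) k.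
                \<Sum>y | y \<in> T \<and> restrict y {1..t} = ypre t j. w (x, y))
           = (\<Sum>x | x \<in> S \<and> restrict x {1..t} = xpre t i \<and> x (t + 1) = xcur (t + 1) k. measure \<mu> {x})
           * (\<Sum>x | x \<in> S \<and> restrict x {1..t} = xpre t i.
                \<Sum>y | y \<in> T \<and> restrict y {1..t} = ypre t j. w (x, y)))})"

end

(* A probability measure concentrated on a finite set of atoms is determined by its atoms, and a
   conditional expectation given Z is the ratio E[f; Z = z] / P(Z = z). Hence conditional independence
   amounts to finitely many identities P(Z = z) P(X = u, Y = v, Z = z) = P(X = u, Z = z) P(Y = v, Z = z),
   which for a causal coupling are the linear constraints of the program, because the terms without Y
   are marginal weights of mu. A finite topological support carries the full mass since the path
   topology has a countable base. The feasible set is compact and contains the product weights, so a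
   minimizer exists. *)

theory Submission
  imports Defs
begin

section \<open>The path space\<close>

text \<open>Measures and weights are compared on the fixed grid
  \<open>supp N \<mu> \<times> supp N \<nu>\<close> rather than on the support of each coupling. One
  index set then serves all couplings, at the price of grid points of mass zero. Finitely supported
  measures are therefore allowed null atoms, and quotients by a conditioning mass are replaced by
  products: if the mass is zero, both sides of the product form vanish, so the identity can be
  demanded for every value without a positivity condition, as in the linear program.

  Atomwise, conditional independence is quadratic in the coupling. It becomes linear only after full
  row sums are replaced by weights of \<mu>, so the causal constraints are translated only for
  measures that already satisfy the marginal constraints.

  Feasibility is characterised for an arbitrary probability measure on the grid. A single
  equivalence then gives both directions: weights of a causal coupling are feasible, and a measure
  built from feasible weights is a causal coupling.\<close>

lemma sets_path_space_singleton:
  assumes "x \<in> {1..N} \<rightarrow>\<^sub>E UNIV"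
  shows "{x} \<in> sets (path_space N)"
proof -
  have "{x} = (\<Pi>\<^sub>E i\<in>{1..N}. {x i})"
    using assms PiE_singleton[of x "{1..N}"] by (simp add: PiE_iff)
  also have "\<dots> \<in> sets (path_space N)"
    unfolding path_space_def by (rule sets_PiM_I_finite) auto
  finally show ?thesis .
qed

lemma space_path_space: "space (path_space N) = {1..N} \<rightarrow>\<^sub>E UNIV"
  by (simp add: path_space_def space_PiM)

lemma topspace_path_topology: "topspace (path_topology N) = {1..N} \<rightarrow>\<^sub>E UNIV"
  by (simp add: path_topology_def)

text \<open>Open boxes with rational endpoints form the base. They are also measurable rectangles,
  so the same family shows that open sets are measurable and later covers the complement of a
  support by countably many null sets.\<close>

lemma path_topology_countable_base:
  obtains \<B> where "countable \<B>" "\<B> \<subseteq> sets (path_space N)"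
    "\<And>U x. openin (path_topology N) U \<Longrightarrow> x \<in> U \<Longrightarrow> \<exists>V\<in>\<B>. x \<in> V \<and> V \<subseteq> U"
proof -
  define Q where "Q = ({1..N} \<rightarrow>\<^sub>E (\<rat> :: real set))"
  define box where "box = (\<lambda>(a, b :: nat \<Rightarrow> real). \<Pi>\<^sub>E i\<in>{1..N}. {a i<..<b i})"
  have "countable (box ` (Q \<times> Q))"
    unfolding Q_def by (intro countable_image countable_SIGMA countable_PiE) (auto simp: countable_rat)
  moreover have "box ` (Q \<times> Q) \<subseteq> sets (path_space N)"
    unfolding box_def path_space_def by (auto intro!: sets_PiM_I_finite)
  moreover have "\<exists>V\<in>box ` (Q \<times> Q). x \<in> V \<and> V \<subseteq> U" if U: "openin (path_topology N) U" "x \<in> U" for U x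
  proof -
    obtain V0 where V0: "\<And>i. i \<in> {1..N} \<Longrightarrow> open (V0 i)" "x \<in> Pi\<^sub>E {1..N} V0" "Pi\<^sub>E {1..N} V0 \<subseteq> U"
      using U unfolding path_topology_def openin_product_topology_alt by (metis open_openin)
    have "\<exists>a b. a \<in> \<rat> \<and> b \<in> \<rat> \<and> a < x i \<and> x i < b \<and> {a<..<b} \<subseteq> V0 i" if i: "i \<in> {1..N}" for i
    proof -
      obtain e where e: "e > 0" "ball (x i) e \<subseteq> V0 i"
        using V0(1)[OF i] V0(2) i by (meson PiE_E open_contains_ball)
      obtain a where a: "a \<in> \<rat>" "x i - e < a" "a < x i"
        using Rats_dense_in_real[of "x i - e" "x i"] e by auto
      obtain b where b: "b \<in> \<rat>" "x i < b" "b < x i + e"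
        using Rats_dense_in_real[of "x i" "x i + e"] e by auto
      have "{a<..<b} \<subseteq> ball (x i) e"
        using a b by (auto simp: dist_real_def)
      then show ?thesis using a b e by blast
    qed
    then obtain a b where ab: "\<And>i. i \<in> {1..N} \<Longrightarrow>
        a i \<in> \<rat> \<and> b i \<in> \<rat> \<and> a i < x i \<and> x i < b i \<and> {a i<..<b i} \<subseteq> V0 i"
      by metis
    \<comment> \<open>The endpoint vectors are cut down to \<open>{1..N}\<close> because the
      countable set \<open>Q\<close> consists of extensional functions; the box itself only looks at
      these coordinates.\<close>
    define V where "V = box (restrict a {1..N}, restrict b {1..N})"
    have V: "V = (\<Pi>\<^sub>E i\<in>{1..N}. {a i<..<b i})"
      unfolding V_def box_def by (auto intro!: PiE_cong)
    have "V \<in> box ` (Q \<times> Q)"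
      unfolding V_def Q_def using ab by (intro imageI) (auto simp: PiE_iff)
    moreover have "x \<in> V"
      using ab V0(2) by (auto simp: V PiE_iff)
    moreover have "V \<subseteq> U"
      using ab V0(3) unfolding V by (meson PiE_mono subset_trans)
    ultimately show ?thesis by blast
  qed
  ultimately show ?thesis using that by blast
qed

lemma sets_if_countable_base:
  assumes "countable \<B>" "\<B> \<subseteq> sets M" "\<And>x. x \<in> U \<Longrightarrow> \<exists>V\<in>\<B>. x \<in> V \<and> V \<subseteq> U"
  shows "U \<in> sets M"
proof -
  have "U = \<Union>{V \<in> \<B>. V \<subseteq> U}"
    using assms(3) by blast
  also have "\<dots> \<in> sets M"
    using assms(1,2) by (intro sets.countable_Union countable_Collect) (auto)
  finally show ?thesis .
qed

lemma sets_path_space_openin: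
  assumes "openin (path_topology N) U"
  shows "U \<in> sets (path_space N)"
  using path_topology_countable_base[of N] sets_if_countable_base assms by metis

text \<open>Continuity refers to the product topology, measurability to the product
  \<sigma>-algebra. The two are reconciled by second countability: an open set of the product is a
  countable union of rectangles of basic sets.\<close>

lemma continuous_map_path_measurable:
  fixes c :: "(nat \<Rightarrow> real) \<times> (nat \<Rightarrow> real) \<Rightarrow> real"
  assumes "continuous_map (prod_topology (path_topology N) (path_topology N)) euclideanreal c"
  shows "c \<in> borel_measurable (path_space N \<Otimes>\<^sub>M path_space N)"
proof (rule borel_measurableI)
  fix G :: "real set"
  assume "open G"
  define U where "U = {z \<in> topspace (prod_topology (path_topology N) (path_topology N)). c z \<in> G}"
  have op: "openin (prod_topology (path_topology N) (path_topology N)) U"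
    unfolding U_def using assms \<open>open G\<close> by (intro openin_continuous_map_preimage) auto
  obtain \<B> where \<B>: "countable \<B>" "\<B> \<subseteq> sets (path_space N)"
    "\<And>U x. openin (path_topology N) U \<Longrightarrow> x \<in> U \<Longrightarrow> \<exists>V\<in>\<B>. x \<in> V \<and> V \<subseteq> U"
    using path_topology_countable_base by blast
  have "U \<in> sets (path_space N \<Otimes>\<^sub>M path_space N)"
  proof (rule sets_if_countable_base)
    show "countable ((\<lambda>(V, W). V \<times> W) ` (\<B> \<times> \<B>))"
      using \<B>(1) by auto
    show "(\<lambda>(V, W). V \<times> W) ` (\<B> \<times> \<B>) \<subseteq> sets (path_space N \<Otimes>\<^sub>M path_space N)"
      using \<B>(2) by auto
    fix z
    assume "z \<in> U"
    then obtain x y where z: "z = (x, y)" "(x, y) \<in> U"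
      by (cases z) auto
    then obtain V W where VW: "openin (path_topology N) V" "openin (path_topology N) W"
        "x \<in> V" "y \<in> W" "V \<times> W \<subseteq> U"
      using op unfolding openin_prod_topology_alt by metis
    obtain V' W' where "V' \<in> \<B>" "W' \<in> \<B>" "x \<in> V'" "V' \<subseteq> V" "y \<in> W'" "W' \<subseteq> W"
      using \<B>(3)[OF VW(1,3)] \<B>(3)[OF VW(2,4)] by blast
    then show "\<exists>V0\<in>(\<lambda>(V, W). V \<times> W) ` (\<B> \<times> \<B>). z \<in> V0 \<and> V0 \<subseteq> U"
      using z VW(5) by (intro bexI[of _ "V' \<times> W'"]) auto
  qed
  also have "U = c -` G \<inter> space (path_space N \<Otimes>\<^sub>M path_space N)"
    by (auto simp: U_def space_pair_measure space_path_space topspace_path_topology)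
  finally show "c -` G \<inter> space (path_space N \<Otimes>\<^sub>M path_space N) \<in> sets (path_space N \<Otimes>\<^sub>M path_space N)" .
qed

section \<open>Finitely supported probability measures\<close>

text \<open>\<open>\<Omega>\<close> is any finite carrier of full mass and may contain atoms of
  probability zero, so that the same grid can be used for every coupling.\<close>

locale finitely_supported_prob = prob_space M for M :: "'a measure" +
  fixes \<Omega> :: "'a set"
  assumes finite_support: "finite \<Omega>"
    and singleton_events: "a \<in> \<Omega> \<Longrightarrow> {a} \<in> events"
    and prob_support: "prob \<Omega> = 1"
begin

lemma support_events: "\<Omega> \<in> events"
proof -
  have "(\<Union>a\<in>\<Omega>. {a}) \<in> events"
    using finite_support singleton_events by (intro sets.finite_UN) auto
  then show ?thesis by simp
qed

lemma support_in_space: "a \<in> \<Omega> \<Longrightarrow> a \<in> space M"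
  using support_events sets.sets_into_space by blast

lemma AE_support: "AE \<omega> in M. \<omega> \<in> \<Omega>"
  using support_events prob_support by (simp add: prob_eq_1)

lemma prob_eq_sum:
  assumes "B \<in> events"
  shows "prob B = (\<Sum>a | a \<in> \<Omega> \<and> a \<in> B. prob {a})"
proof -
  have "prob B = prob {a. a \<in> \<Omega> \<and> a \<in> B}"
  proof (rule finite_measure_eq_AE)
    show "AE x in M. (x \<in> B) = (x \<in> {a. a \<in> \<Omega> \<and> a \<in> B})"
      using AE_support by eventually_elim auto
    have "\<Omega> \<inter> B \<in> events" using assms support_events by auto
    then show "{a. a \<in> \<Omega> \<and> a \<in> B} \<in> events"
      by (simp add: Int_def)
  qed (use assms in auto)
  also have "\<dots> = (\<Sum>a | a \<in> \<Omega> \<and> a \<in> B. prob {a})"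
    using finite_support singleton_events by (intro finite_measure_eq_sum_singleton) auto
  finally show ?thesis .
qed

lemma sum_prob_support: "(\<Sum>a\<in>\<Omega>. prob {a}) = 1"
  using prob_eq_sum[OF support_events] prob_support by simp

text \<open>A null set cannot contain an atom of positive mass; conversely the exceptional set is
  covered by the complement of \<open>\<Omega>\<close> and finitely many null atoms.\<close>

lemma AE_iff_support: "(AE \<omega> in M. P \<omega>) \<longleftrightarrow> (\<forall>a\<in>\<Omega>. prob {a} > 0 \<longrightarrow> P a)"
proof
  assume "AE \<omega> in M. P \<omega>"
  then obtain Z where Z: "{\<omega> \<in> space M. \<not> P \<omega>} \<subseteq> Z" "emeasure M Z = 0" "Z \<in> events"
    by (rule AE_E)
  show "\<forall>a\<in>\<Omega>. prob {a} > 0 \<longrightarrow> P a"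
  proof (intro ballI impI, rule ccontr)
    fix a
    assume a: "a \<in> \<Omega>" "prob {a} > 0" "\<not> P a"
    then have "{a} \<subseteq> Z" using Z(1) support_in_space by auto
    then have "prob {a} \<le> prob Z" using Z(3) by (rule finite_measure_mono)
    then show False using a(2) Z(2) by (simp add: measure_def)
  qed
next
  assume P: "\<forall>a\<in>\<Omega>. prob {a} > 0 \<longrightarrow> P a"
  have "AE \<omega> in M. \<forall>a\<in>{a \<in> \<Omega>. prob {a} = 0}. \<omega> \<noteq> a"
  proof (rule AE_finite_allI)
    fix a
    assume a: "a \<in> {a \<in> \<Omega>. prob {a} = 0}"
    then have "{a} \<in> null_sets M"
      using singleton_events by (auto simp: null_sets_def emeasure_eq_measure)
    then show "AE \<omega> in M. \<omega> \<noteq> a"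
      using AE_not_in by force
  qed (use finite_support in auto)
  with AE_support have "AE \<omega> in M. \<omega> \<in> \<Omega> \<and> (\<forall>a\<in>{a \<in> \<Omega>. prob {a} = 0}. \<omega> \<noteq> a)"
    by (rule AE_conjI)
  then show "AE \<omega> in M. P \<omega>"
    by (rule eventually_mono) (use P in \<open>auto simp: less_le\<close>)
qed

section \<open>Integrals and conditional expectations as finite sums\<close>

lemma has_integral_support:
  fixes f :: "'a \<Rightarrow> real"
  assumes [measurable]: "f \<in> borel_measurable M"
  shows "has_bochner_integral M f (\<Sum>a\<in>\<Omega>. f a * prob {a})"
proof -
  have meas: "{a} \<in> events" if "a \<in> \<Omega>" for a using that singleton_events by blast
  have "has_bochner_integral M (\<lambda>x. \<Sum>a\<in>\<Omega>. f a * indicator {a} x) (\<Sum>a\<in>\<Omega>. f a * prob {a})"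
    using meas by (intro has_bochner_integral_sum has_bochner_integral_mult_right
        has_bochner_integral_real_indicator) (auto simp: emeasure_eq_measure)
  moreover have "AE x in M. (\<Sum>a\<in>\<Omega>. f a * indicator {a} x) = f x"
    using AE_support
    by eventually_elim (simp add: finite_support indicator_def if_distrib sum.delta' cong: if_cong)
  ultimately show ?thesis
    using assms meas by (subst has_bochner_integral_cong_AE[symmetric, where f="\<lambda>x. \<Sum>a\<in>\<Omega>. f a * indicator {a} x"]) auto
qed

text \<open>No bound on \<open>f\<close> is involved, since \<open>f\<close> agrees almost
  everywhere with a finite combination of indicators; this is why the cost is integrable under every
  coupling.\<close>

lemma integrable_support:
  fixes f :: "'a \<Rightarrow> real"
  shows "f \<in> borel_measurable M \<Longrightarrow> integrable M f"
  using has_integral_support by (metis has_bochner_integral_iff)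

lemma integral_support:
  fixes f :: "'a \<Rightarrow> real"
  shows "f \<in> borel_measurable M \<Longrightarrow> (\<integral>x. f x \<partial>M) = (\<Sum>a\<in>\<Omega>. f a * prob {a})"
  using has_integral_support by (metis has_bochner_integral_iff)

text \<open>The ratio is recognised as the conditional expectation by its characteristic property:
  it is a measurable function of \<open>Z\<close> and has the same integral as \<open>f\<close> over
  every set determined by \<open>Z\<close>.\<close>

lemma real_cond_exp_support:
  fixes f :: "'a \<Rightarrow> real"
  assumes Z[measurable]: "Z \<in> measurable M MZ" and sing: "\<And>a. a \<in> \<Omega> \<Longrightarrow> {Z a} \<in> sets MZ"
    and f[measurable]: "f \<in> borel_measurable M"
  shows "AE \<omega> in M. real_cond_exp M (vimage_algebra (space M) Z MZ) f \<omega> =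
    (\<Sum>a | a \<in> \<Omega> \<and> Z a = Z \<omega>. f a * prob {a}) / (\<Sum>a | a \<in> \<Omega> \<and> Z a = Z \<omega>. prob {a})"
proof -
  define F where "F = vimage_algebra (space M) Z MZ"
  define p where "p z = (\<Sum>a | a \<in> \<Omega> \<and> Z a = z. prob {a})" for z
  define q where "q z = (\<Sum>a | a \<in> \<Omega> \<and> Z a = z. f a * prob {a})" for z
  have Z_space: "Z \<in> space M \<rightarrow> space MZ"
    using measurable_space[OF Z] by auto
  have sub: "subalgebra M F"
    unfolding subalgebra_def F_def using Z by (auto simp: sets_vimage_algebra2[OF Z_space])
  interpret finite_measure_subalgebra M F
    by unfold_locales (rule sub)
  \<comment> \<open>A fibre of mass zero has only null atoms, so its numerator vanishes as well and
    the convention \<open>x / 0 = 0\<close> does no harm.\<close>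
  have q: "q z = q z / p z * p z" for z
  proof (cases "p z = 0")
    case True
    then have "\<forall>a\<in>{a. a \<in> \<Omega> \<and> Z a = z}. prob {a} = 0"
      unfolding p_def using finite_support by (subst (asm) sum_nonneg_eq_0_iff) auto
    then show ?thesis by (simp add: q_def)
  qed simp
  have "(\<lambda>z. \<Sum>z'\<in>Z ` \<Omega>. q z' / p z' * indicator {z'} z) = (\<lambda>z. q z / p z)"
  proof
    fix z
    have "q z / p z = 0" if "z \<notin> Z ` \<Omega>"
    proof -
      have "{a. a \<in> \<Omega> \<and> Z a = z} = {}" using that by auto
      then show ?thesis unfolding p_def by (simp only: sum.empty div_by_0)
    qed
    moreover have "(\<Sum>z'\<in>Z ` \<Omega>. q z' / p z' * indicator {z'} z) = (\<Sum>z'\<in>Z ` \<Omega>. if z = z' then q z' / p z' else 0)"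
      by (intro sum.cong) auto
    ultimately show "(\<Sum>z'\<in>Z ` \<Omega>. q z' / p z' * indicator {z'} z) = q z / p z"
      using finite_support by (simp add: sum.delta)
  qed
  moreover have "(\<lambda>z. \<Sum>z'\<in>Z ` \<Omega>. q z' / p z' * indicator {z'} z) \<in> borel_measurable MZ"
    using sing by (intro borel_measurable_sum borel_measurable_times borel_measurable_const
        borel_measurable_indicator) auto
  ultimately have qp[measurable]: "(\<lambda>z. q z / p z) \<in> borel_measurable MZ"
    by metis
  have "AE \<omega> in M. real_cond_exp M F f \<omega> = q (Z \<omega>) / p (Z \<omega>)"
  proof (rule real_cond_exp_charact)
    show "integrable M f" "integrable M (\<lambda>\<omega>. q (Z \<omega>) / p (Z \<omega>))"
      using measurable_compose[OF Z qp] f by (auto intro: integrable_support)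
    show "(\<lambda>\<omega>. q (Z \<omega>) / p (Z \<omega>)) \<in> borel_measurable F"
      unfolding F_def using measurable_vimage_algebra1[OF Z_space] qp by (rule measurable_compose)
    fix A
    assume "A \<in> sets F"
    then obtain C where C: "C \<in> sets MZ" "A = Z -` C \<inter> space M"
      unfolding F_def by (auto simp: sets_vimage_algebra2[OF Z_space])
    have A: "A \<in> events" using C by simp
    have ind: "indicator A a = (indicator C (Z a) :: real)" if "a \<in> \<Omega>" for a
      using that C support_in_space by (auto simp: indicator_def)
    have "(\<integral>x\<in>A. f x \<partial>M) = (\<Sum>a\<in>\<Omega>. indicator C (Z a) * (f a * prob {a}))"
      unfolding set_lebesgue_integral_def using A
      by (subst integral_support) (auto simp: ind mult_ac intro!: sum.cong)
    \<comment> \<open>The sum is grouped by the fibres of \<open>Z\<close>, on which the indicator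
      of \<open>C\<close> is constant. Each fibre total \<open>q z\<close> is then rewritten as the
      ratio times the fibre mass and spread over the atoms again.\<close>
    also have "\<dots> = (\<Sum>z\<in>Z ` \<Omega>. indicator C z * q z)"
      unfolding q_def sum_distrib_left
      by (subst sum.image_gen[OF finite_support, of _ Z]) (auto intro!: sum.cong)
    also have "\<dots> = (\<Sum>z\<in>Z ` \<Omega>. indicator C z * (q z / p z * p z))"
      using q by metis
    also have "\<dots> = (\<Sum>a\<in>\<Omega>. indicator C (Z a) * (q (Z a) / p (Z a) * prob {a}))"
    proof -
      have "(\<Sum>a\<in>\<Omega>. indicator C (Z a) * (q (Z a) / p (Z a) * prob {a})) =
          (\<Sum>z\<in>Z ` \<Omega>. \<Sum>a | a \<in> \<Omega> \<and> Z a = z. indicator C (Z a) * (q (Z a) / p (Z a) * prob {a}))"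
        by (rule sum.image_gen[OF finite_support])
      also have "\<dots> = (\<Sum>z\<in>Z ` \<Omega>. \<Sum>a | a \<in> \<Omega> \<and> Z a = z. indicator C z * (q z / p z * prob {a}))"
        by (intro sum.cong refl) simp
      also have "\<dots> = (\<Sum>z\<in>Z ` \<Omega>. indicator C z * (q z / p z * p z))"
        by (intro sum.cong refl) (simp only: sum_distrib_left[symmetric] p_def[symmetric])
      finally show ?thesis by (rule sym)
    qed
    also have "\<dots> = (\<integral>x\<in>A. q (Z x) / p (Z x) \<partial>M)"
      unfolding set_lebesgue_integral_def
      by (subst integral_support[OF borel_measurable_scaleR[OF borel_measurable_indicator[OF A] measurable_compose[OF Z qp]]])
        (auto simp: ind mult_ac intro!: sum.cong)
    finally show "(\<integral>x\<in>A. f x \<partial>M) = (\<integral>x\<in>A. q (Z x) / p (Z x) \<partial>M)" .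
  qed
  then show ?thesis unfolding F_def p_def q_def .
qed

end

section \<open>Conditional independence in terms of atoms\<close>

lemma sum_indicator_times:
  fixes w :: "'a \<Rightarrow> real"
  assumes "finite V" "\<And>a. a \<in> I \<Longrightarrow> X a \<in> V"
  shows "(\<Sum>a\<in>I. indicator A (X a) * w a) = (\<Sum>u\<in>V. indicator A u * (\<Sum>a\<in>I. indicator {u} (X a) * w a))"
proof -
  have "indicator A x = (\<Sum>u\<in>V. indicator A u * indicator {u} x :: real)" if "x \<in> V" for x
  proof -
    have "(\<Sum>u\<in>V. indicator A u * indicator {u} x) = (\<Sum>u\<in>V. if x = u then indicator A u else 0 :: real)"
      by (intro sum.cong) auto
    then show ?thesis using assms(1) that by (simp add: sum.delta)
  qed
  then have "(\<Sum>a\<in>I. indicator A (X a) * w a) = (\<Sum>a\<in>I. \<Sum>u\<in>V. indicator A u * (indicator {u} (X a) * w a))"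
    using assms(2) by (intro sum.cong) (simp_all add: sum_distrib_right mult.assoc)
  also have "\<dots> = (\<Sum>u\<in>V. \<Sum>a\<in>I. indicator A u * (indicator {u} (X a) * w a))"
    by (rule sum.swap)
  finally show ?thesis by (simp add: sum_distrib_left)
qed

context finitely_supported_prob
begin

lemma AE_cond_exp_factor_iff:
  assumes X[measurable]: "X \<in> measurable M MX" and Y[measurable]: "Y \<in> measurable M MY"
    and Z: "Z \<in> measurable M MZ" and sing: "\<And>a. a \<in> \<Omega> \<Longrightarrow> {Z a} \<in> sets MZ"
    and A[measurable]: "A \<in> sets MX" and B[measurable]: "B \<in> sets MY"
  defines "F \<equiv> vimage_algebra (space M) Z MZ"
  shows "(AE \<omega> in M. real_cond_exp M F (\<lambda>\<omega>. indicator A (X \<omega>) * indicator B (Y \<omega>)) \<omega>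
      = real_cond_exp M F (\<lambda>\<omega>. indicator A (X \<omega>)) \<omega> * real_cond_exp M F (\<lambda>\<omega>. indicator B (Y \<omega>)) \<omega>) \<longleftrightarrow>
    (\<forall>z\<in>Z ` \<Omega>. (\<Sum>a | a \<in> \<Omega> \<and> Z a = z. prob {a})
        * (\<Sum>a | a \<in> \<Omega> \<and> Z a = z. indicator A (X a) * indicator B (Y a) * prob {a})
      = (\<Sum>a | a \<in> \<Omega> \<and> Z a = z. indicator A (X a) * prob {a})
        * (\<Sum>a | a \<in> \<Omega> \<and> Z a = z. indicator B (Y a) * prob {a}))"
proof -
  define p where "p z = (\<Sum>a | a \<in> \<Omega> \<and> Z a = z. prob {a})" for z
  define q where "q f z = (\<Sum>a | a \<in> \<Omega> \<and> Z a = z. f a * prob {a})" for f z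
  define XA YB :: "'a \<Rightarrow> real" where "XA \<omega> = indicator A (X \<omega>)" and "YB \<omega> = indicator B (Y \<omega>)" for \<omega>
  have meas: "XA \<in> borel_measurable M" "YB \<in> borel_measurable M" "(\<lambda>\<omega>. XA \<omega> * YB \<omega>) \<in> borel_measurable M"
    unfolding XA_def YB_def by measurable
  let ?E = "\<lambda>z. q (\<lambda>\<omega>. XA \<omega> * YB \<omega>) z / p z = q XA z / p z * (q YB z / p z)"
  have ce: "AE \<omega> in M. real_cond_exp M F f \<omega> = q f (Z \<omega>) / p (Z \<omega>)" if "f \<in> borel_measurable M" for f
    using real_cond_exp_support[OF Z sing that] unfolding F_def p_def q_def .
  have "(AE \<omega> in M. real_cond_exp M F (\<lambda>\<omega>. XA \<omega> * YB \<omega>) \<omega> = real_cond_exp M F XA \<omega> * real_cond_exp M F YB \<omega>)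
    \<longleftrightarrow> (AE \<omega> in M. q (\<lambda>\<omega>. XA \<omega> * YB \<omega>) (Z \<omega>) / p (Z \<omega>)
         = q XA (Z \<omega>) / p (Z \<omega>) * (q YB (Z \<omega>) / p (Z \<omega>)))" (is "?L \<longleftrightarrow> ?R")
  proof
    assume ?L
    with ce[OF meas(1)] ce[OF meas(2)] ce[OF meas(3)] show ?R
      by eventually_elim metis
  next
    assume ?R
    with ce[OF meas(1)] ce[OF meas(2)] ce[OF meas(3)] show ?L
      by eventually_elim metis
  qed
  also have "\<dots> \<longleftrightarrow> (\<forall>a\<in>\<Omega>. prob {a} > 0 \<longrightarrow> ?E (Z a))"
    by (rule AE_iff_support)
  \<comment> \<open>The condition depends on an atom only through its fibre, and a fibre has
    positive mass exactly when one of its atoms does.\<close>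
  also have "\<dots> \<longleftrightarrow> (\<forall>z\<in>Z ` \<Omega>. p z > 0 \<longrightarrow> ?E z)"
  proof (intro iffI ballI impI)
    fix z
    assume *: "\<forall>a\<in>\<Omega>. prob {a} > 0 \<longrightarrow> ?E (Z a)" and z: "p z > 0"
    have "\<exists>a\<in>{a. a \<in> \<Omega> \<and> Z a = z}. prob {a} \<noteq> 0"
    proof (rule ccontr)
      assume "\<not> ?thesis"
      then have "p z = 0" unfolding p_def by (intro sum.neutral) blast
      then show False using z by simp
    qed
    then obtain a where "a \<in> \<Omega>" "Z a = z" "prob {a} > 0"
      by (auto simp: zero_less_measure_iff)
    then show "?E z" using * by blast
  next
    fix a
    assume *: "\<forall>z\<in>Z ` \<Omega>. p z > 0 \<longrightarrow> ?E z" and a: "a \<in> \<Omega>" "prob {a} > 0"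
    have "p (Z a) \<ge> prob {a}"
      unfolding p_def using finite_support a by (intro member_le_sum) auto
    then have "p (Z a) > 0" using a by linarith
    then show "?E (Z a)" using * a by blast
  qed
  also have "\<dots> \<longleftrightarrow> (\<forall>z\<in>Z ` \<Omega>. p z * q (\<lambda>\<omega>. XA \<omega> * YB \<omega>) z = q XA z * q YB z)"
  proof (intro ball_cong refl)
    fix z
    have p: "p z \<ge> 0" unfolding p_def by (simp add: sum_nonneg)
    show "(p z > 0 \<longrightarrow> ?E z) \<longleftrightarrow> p z * q (\<lambda>\<omega>. XA \<omega> * YB \<omega>) z = q XA z * q YB z"
    proof (cases "p z = 0")
      case True
      then have "\<forall>a\<in>{a. a \<in> \<Omega> \<and> Z a = z}. prob {a} = 0"
        unfolding p_def using finite_support by (subst (asm) sum_nonneg_eq_0_iff) auto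
      then have "q f z = 0" for f unfolding q_def by (intro sum.neutral) auto
      with True show ?thesis by simp
    next
      case False
      \<comment> \<open>Both sides are brought to the denominator \<open>p z * p z\<close>: the left
        ratio has only one factor \<open>p z\<close> below, so it is expanded by another, which is
        the factor surviving in the product form.\<close>
      have "?E z \<longleftrightarrow> q (\<lambda>\<omega>. XA \<omega> * YB \<omega>) z * p z / (p z * p z) = q XA z * q YB z / (p z * p z)"
        using False by simp
      also have "\<dots> \<longleftrightarrow> p z * q (\<lambda>\<omega>. XA \<omega> * YB \<omega>) z = q XA z * q YB z"
        using False by (subst divide_cancel_right) (simp add: mult.commute)
      finally have "?E z \<longleftrightarrow> p z * q (\<lambda>\<omega>. XA \<omega> * YB \<omega>) z = q XA z * q YB z" .
      moreover have "p z > 0" using False p by linarith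
      ultimately show ?thesis by blast
    qed
  qed
  finally show ?thesis unfolding p_def q_def XA_def YB_def .
qed

text \<open>For fixed \<open>z\<close> the two sides are bilinear in the indicators of
  \<open>A\<close> and \<open>B\<close>. Only finitely many values of \<open>X\<close> and
  \<open>Y\<close> matter, so both indicators expand into those of singletons and the identity
  follows from its atomic case. Conversely, measurable singletons are admissible choices of
  \<open>A\<close> and \<open>B\<close>.\<close>

lemma cond_indep_given_iff:
  assumes X: "X \<in> measurable M MX" and Y: "Y \<in> measurable M MY" and Z: "Z \<in> measurable M MZ"
    and singX: "\<And>a. a \<in> \<Omega> \<Longrightarrow> {X a} \<in> sets MX" and singY: "\<And>a. a \<in> \<Omega> \<Longrightarrow> {Y a} \<in> sets MY"
    and singZ: "\<And>a. a \<in> \<Omega> \<Longrightarrow> {Z a} \<in> sets MZ"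
  shows "cond_indep_given M MX X MY Y MZ Z \<longleftrightarrow>
    (\<forall>z\<in>Z ` \<Omega>. \<forall>u\<in>X ` \<Omega>. \<forall>v\<in>Y ` \<Omega>.
      (\<Sum>a | a \<in> \<Omega> \<and> Z a = z. prob {a}) * (\<Sum>a | a \<in> \<Omega> \<and> Z a = z \<and> X a = u \<and> Y a = v. prob {a})
      = (\<Sum>a | a \<in> \<Omega> \<and> Z a = z \<and> X a = u. prob {a}) * (\<Sum>a | a \<in> \<Omega> \<and> Z a = z \<and> Y a = v. prob {a}))"
    (is "_ \<longleftrightarrow> ?atoms")
proof -
  define p where "p z = (\<Sum>a | a \<in> \<Omega> \<and> Z a = z. prob {a})" for z
  define q where "q f z = (\<Sum>a | a \<in> \<Omega> \<and> Z a = z. f a * prob {a})" for f z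
  have qX: "q (\<lambda>a. indicator A (X a)) z = (\<Sum>u\<in>X ` \<Omega>. indicator A u * q (\<lambda>a. indicator {u} (X a)) z)" for A z
    unfolding q_def using finite_support by (intro sum_indicator_times) auto
  have qY: "q (\<lambda>a. indicator B (Y a)) z = (\<Sum>v\<in>Y ` \<Omega>. indicator B v * q (\<lambda>a. indicator {v} (Y a)) z)" for B z
    unfolding q_def using finite_support by (intro sum_indicator_times) auto
  have qXY: "q (\<lambda>a. indicator A (X a) * indicator B (Y a)) z =
      (\<Sum>u\<in>X ` \<Omega>. \<Sum>v\<in>Y ` \<Omega>. indicator A u * indicator B v * q (\<lambda>a. indicator {u} (X a) * indicator {v} (Y a)) z)"
    for A B z
  proof -
    have "q (\<lambda>a. indicator A (X a) * indicator B (Y a)) z =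
        (\<Sum>a | a \<in> \<Omega> \<and> Z a = z. indicator A (X a) * (indicator B (Y a) * prob {a}))"
      unfolding q_def by (simp add: mult.assoc)
    also have "\<dots> = (\<Sum>u\<in>X ` \<Omega>. indicator A u *
        (\<Sum>a | a \<in> \<Omega> \<and> Z a = z. indicator {u} (X a) * (indicator B (Y a) * prob {a})))"
      using finite_support by (intro sum_indicator_times) auto
    \<comment> \<open>Moving the factor with \<open>Y\<close> to the front lets the expansion be
      applied a second time, now to \<open>B\<close>.\<close>
    also have "\<dots> = (\<Sum>u\<in>X ` \<Omega>. indicator A u *
        (\<Sum>a | a \<in> \<Omega> \<and> Z a = z. indicator B (Y a) * (indicator {u} (X a) * prob {a})))"
      by (simp only: mult.left_commute)
    also have "\<dots> = (\<Sum>u\<in>X ` \<Omega>. indicator A u * (\<Sum>v\<in>Y ` \<Omega>. indicator B v *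
        (\<Sum>a | a \<in> \<Omega> \<and> Z a = z. indicator {v} (Y a) * (indicator {u} (X a) * prob {a}))))"
      using finite_support by (intro sum.cong refl arg_cong2[where f="(*)"] sum_indicator_times) auto
    finally show ?thesis
      unfolding q_def sum_distrib_left by (simp only: mult_ac)
  qed
  have atoms: "?atoms \<longleftrightarrow> (\<forall>z\<in>Z ` \<Omega>. \<forall>u\<in>X ` \<Omega>. \<forall>v\<in>Y ` \<Omega>.
      p z * q (\<lambda>a. indicator {u} (X a) * indicator {v} (Y a)) z = q (\<lambda>a. indicator {u} (X a)) z * q (\<lambda>a. indicator {v} (Y a)) z)"
  proof -
    have "q (\<lambda>a. indicator {u} (X a)) z = (\<Sum>a | a \<in> \<Omega> \<and> Z a = z \<and> X a = u. prob {a})" for u z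
      unfolding q_def using finite_support by (intro sum.mono_neutral_cong_right) auto
    moreover have "q (\<lambda>a. indicator {v} (Y a)) z = (\<Sum>a | a \<in> \<Omega> \<and> Z a = z \<and> Y a = v. prob {a})" for v z
      unfolding q_def using finite_support by (intro sum.mono_neutral_cong_right) auto
    moreover have "q (\<lambda>a. indicator {u} (X a) * indicator {v} (Y a)) z =
        (\<Sum>a | a \<in> \<Omega> \<and> Z a = z \<and> X a = u \<and> Y a = v. prob {a})" for u v z
      unfolding q_def using finite_support
      by (intro sum.mono_neutral_cong_right) (auto split: split_indicator_asm split_indicator)
    ultimately show ?thesis unfolding p_def by simp
  qed
  have "cond_indep_given M MX X MY Y MZ Z \<longleftrightarrow> (\<forall>A\<in>sets MX. \<forall>B\<in>sets MY. \<forall>z\<in>Z ` \<Omega>.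
      p z * q (\<lambda>a. indicator A (X a) * indicator B (Y a)) z = q (\<lambda>a. indicator A (X a)) z * q (\<lambda>a. indicator B (Y a)) z)"
    unfolding cond_indep_given_def p_def q_def
    using X Y Z by (simp add: AE_cond_exp_factor_iff[OF X Y Z singZ])
  also have "\<dots> \<longleftrightarrow> ?atoms"
    unfolding atoms
  proof (intro iffI ballI)
    fix z u v
    assume "\<forall>A\<in>sets MX. \<forall>B\<in>sets MY. \<forall>z\<in>Z ` \<Omega>.
      p z * q (\<lambda>a. indicator A (X a) * indicator B (Y a)) z = q (\<lambda>a. indicator A (X a)) z * q (\<lambda>a. indicator B (Y a)) z"
      and "z \<in> Z ` \<Omega>" "u \<in> X ` \<Omega>" "v \<in> Y ` \<Omega>"
    then show "p z * q (\<lambda>a. indicator {u} (X a) * indicator {v} (Y a)) z =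
        q (\<lambda>a. indicator {u} (X a)) z * q (\<lambda>a. indicator {v} (Y a)) z"
      using singX singY by auto
  next
    fix A B z
    assume *: "\<forall>z\<in>Z ` \<Omega>. \<forall>u\<in>X ` \<Omega>. \<forall>v\<in>Y ` \<Omega>. p z * q (\<lambda>a. indicator {u} (X a) * indicator {v} (Y a)) z =
        q (\<lambda>a. indicator {u} (X a)) z * q (\<lambda>a. indicator {v} (Y a)) z" and z: "z \<in> Z ` \<Omega>"
    have "p z * q (\<lambda>a. indicator A (X a) * indicator B (Y a)) z =
      (\<Sum>u\<in>X ` \<Omega>. \<Sum>v\<in>Y ` \<Omega>. indicator A u * indicator B v * (p z * q (\<lambda>a. indicator {u} (X a) * indicator {v} (Y a)) z))"
      unfolding qXY[of A B] sum_distrib_left by (simp add: mult_ac)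
    also have "\<dots> = (\<Sum>u\<in>X ` \<Omega>. \<Sum>v\<in>Y ` \<Omega>.
        (indicator A u * q (\<lambda>a. indicator {u} (X a)) z) * (indicator B v * q (\<lambda>a. indicator {v} (Y a)) z))"
      by (intro sum.cong refl, subst *[rule_format, OF z]) (simp_all add: mult_ac)
    also have "\<dots> = q (\<lambda>a. indicator A (X a)) z * q (\<lambda>a. indicator B (Y a)) z"
      unfolding qX[of A] qY[of B] sum_product ..
    finally show "p z * q (\<lambda>a. indicator A (X a) * indicator B (Y a)) z =
        q (\<lambda>a. indicator A (X a)) z * q (\<lambda>a. indicator B (Y a)) z" .
  qed
  finally show ?thesis .
qed

section \<open>Images, uniqueness and construction of finitely supported laws\<close>

lemma measure_distr_singleton:
  assumes f: "f \<in> measurable M K" and "{u} \<in> sets K"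
  shows "measure (distr M K f) {u} = (\<Sum>a | a \<in> \<Omega> \<and> f a = u. prob {a})"
proof -
  have "measure (distr M K f) {u} = prob (f -` {u} \<inter> space M)"
    using assms by (rule measure_distr)
  also have "\<dots> = (\<Sum>a | a \<in> \<Omega> \<and> a \<in> f -` {u} \<inter> space M. prob {a})"
    using assms by (intro prob_eq_sum) auto
  also have "{a. a \<in> \<Omega> \<and> a \<in> f -` {u} \<inter> space M} = {a. a \<in> \<Omega> \<and> f a = u}"
    using support_in_space by auto
  finally show ?thesis .
qed

lemma finitely_supported_distr:
  assumes f: "f \<in> measurable M K" and sing: "\<And>a. a \<in> \<Omega> \<Longrightarrow> {f a} \<in> sets K"
  shows "finitely_supported_prob (distr M K f) (f ` \<Omega>)"
proof -
  interpret D: prob_space "distr M K f" using f by (rule prob_space_distr)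
  have ev: "f ` \<Omega> \<in> sets K"
  proof -
    have "(\<Union>a\<in>\<Omega>. {f a}) \<in> sets K" using finite_support sing by (intro sets.finite_UN) auto
    then show ?thesis by (simp add: UNION_singleton_eq_range)
  qed
  have "prob (f -` f ` \<Omega> \<inter> space M) \<ge> prob \<Omega>"
    using f ev support_in_space by (intro finite_measure_mono) auto
  then have "prob (f -` f ` \<Omega> \<inter> space M) = 1"
    using prob_support prob_le_1 by (simp add: antisym)
  then have "measure (distr M K f) (f ` \<Omega>) = 1"
    using f ev by (simp add: measure_distr)
  then show ?thesis
    using finite_support sing by unfold_locales auto
qed

end

lemma finitely_supported_prob_eqI:
  assumes "finitely_supported_prob M \<Omega>" "finitely_supported_prob M' \<Omega>" "sets M = sets M'"
    and "\<And>a. a \<in> \<Omega> \<Longrightarrow> measure M {a} = measure M' {a}"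
  shows "M = M'"
proof (rule measure_eqI)
  interpret M: finitely_supported_prob M \<Omega> by fact
  interpret M': finitely_supported_prob M' \<Omega> by fact
  fix A
  assume "A \<in> sets M"
  then show "emeasure M A = emeasure M' A"
    using assms(3,4) by (simp add: M.emeasure_eq_measure M'.emeasure_eq_measure M.prob_eq_sum M'.prob_eq_sum)
qed fact

text \<open>Source of the measures that make the passage to weights surjective. The weights first
  define a measure on all subsets of \<open>\<Omega>\<close>, which is then pushed to the prescribed
  \<sigma>-algebra by the identity.\<close>

lemma finitely_supported_prob_exists:
  fixes w :: "'a \<Rightarrow> real"
  assumes fin: "finite \<Omega>" and sing: "\<And>a. a \<in> \<Omega> \<Longrightarrow> {a} \<in> sets K"
    and nonneg: "\<And>a. a \<in> \<Omega> \<Longrightarrow> w a \<ge> 0" and sum: "(\<Sum>a\<in>\<Omega>. w a) = 1"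
  obtains M where "sets M = sets K" "finitely_supported_prob M \<Omega>" "\<And>a. a \<in> \<Omega> \<Longrightarrow> measure M {a} = w a"
proof -
  define P where "P = point_measure \<Omega> (\<lambda>a. ennreal (w a))"
  have space: "space P = \<Omega>" and sets: "sets P = Pow \<Omega>"
    by (simp_all add: P_def space_point_measure sets_point_measure)
  have em: "emeasure P A = ennreal (\<Sum>a\<in>A. w a)" if "A \<subseteq> \<Omega>" for A
    unfolding P_def using that nonneg by (subst emeasure_point_measure_finite[OF fin])
      (auto intro!: sum_ennreal)
  have ms: "measure P {a} = w a" if "a \<in> \<Omega>" for a
    using em[of "{a}"] that nonneg by (simp add: measure_def)
  have "finitely_supported_prob P \<Omega>"
  proof -
    have "emeasure P (space P) = 1" using em[of \<Omega>] space sum by simp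
    then interpret prob_space P by (rule prob_spaceI)
    show ?thesis
      by unfold_locales (use fin sets prob_space space in auto)
  qed
  then interpret P: finitely_supported_prob P \<Omega> .
  \<comment> \<open>Every subset of \<open>\<Omega>\<close> is measurable for \<open>P\<close>, so
    only \<open>\<Omega> \<subseteq> space K\<close> has to be checked.\<close>
  have id: "(\<lambda>a. a) \<in> measurable P K"
    using sing sets.sets_into_space[OF sing] unfolding measurable_def by (auto simp: space sets)
  have "finitely_supported_prob (distr P K (\<lambda>a. a)) \<Omega>"
    using P.finitely_supported_distr[OF id sing] by simp
  moreover have "measure (distr P K (\<lambda>a. a)) {a} = w a" if "a \<in> \<Omega>" for a
  proof -
    have "{b. b \<in> \<Omega> \<and> b = a} = {a}" using that by auto
    then show ?thesis using P.measure_distr_singleton[OF id sing[OF that]] ms[OF that] by simp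
  qed
  ultimately show ?thesis using that[of "distr P K (\<lambda>a. a)"] by simp
qed

section \<open>Couplings of finitely supported marginals\<close>

text \<open>A point outside the support has an open neighbourhood of mass zero, hence a basic one of
  mass zero. There may be uncountably many such points, but only countably many basic sets, whose
  union is still null.\<close>

lemma finitely_supported_supp:
  assumes \<mu>: "\<mu> \<in> space (prob_algebra (path_space N))" and fin: "finite (supp N \<mu>)"
  shows "finitely_supported_prob \<mu> (supp N \<mu>)"
proof -
  have sets: "sets \<mu> = sets (path_space N)" and "prob_space \<mu>"
    using \<mu> by (auto simp: space_prob_algebra)
  interpret prob_space \<mu> by fact
  have space: "space \<mu> = topspace (path_topology N)"
    using sets_eq_imp_space_eq[OF sets] by (simp add: space_path_space topspace_path_topology)
  have sing: "{a} \<in> events" if "a \<in> supp N \<mu>" for a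
    using that sets_path_space_singleton[of a N] by (auto simp: supp_def topspace_path_topology sets)
  have ev: "supp N \<mu> \<in> events"
  proof -
    have "(\<Union>a\<in>supp N \<mu>. {a}) \<in> events" using fin sing by (intro sets.finite_UN) auto
    then show ?thesis by simp
  qed
  obtain \<B> where \<B>: "countable \<B>" "\<B> \<subseteq> sets (path_space N)"
    "\<And>U x. openin (path_topology N) U \<Longrightarrow> x \<in> U \<Longrightarrow> \<exists>V\<in>\<B>. x \<in> V \<and> V \<subseteq> U"
    using path_topology_countable_base by blast
  have null: "\<Union>{V \<in> \<B>. V \<in> null_sets \<mu>} \<in> null_sets \<mu>"
    using null_sets_UN'[of "{V \<in> \<B>. V \<in> null_sets \<mu>}" id \<mu>] \<B>(1) by simp
  have "space \<mu> - supp N \<mu> \<subseteq> \<Union>{V \<in> \<B>. V \<in> null_sets \<mu>}"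
  proof
    fix x
    assume "x \<in> space \<mu> - supp N \<mu>"
    then obtain U where U: "openin (path_topology N) U" "x \<in> U" "\<not> prob U > 0"
      by (auto simp: supp_def space)
    then obtain V where V: "V \<in> \<B>" "x \<in> V" "V \<subseteq> U" using \<B>(3) by blast
    have "prob V \<le> prob U"
      using V(3) sets_path_space_openin[OF U(1)] sets by (intro finite_measure_mono) auto
    then have "prob V = 0" using U(3) measure_nonneg[of \<mu> V] by linarith
    then have "V \<in> null_sets \<mu>"
      using V(1) \<B>(2) sets by (auto simp: null_sets_def emeasure_eq_measure)
    then show "x \<in> \<Union>{V \<in> \<B>. V \<in> null_sets \<mu>}" using V by blast
  qed
  then have "AE x in \<mu>. x \<in> supp N \<mu>"
    using null by (intro AE_I'[of "\<Union>{V \<in> \<B>. V \<in> null_sets \<mu>}"]) auto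
  then have "prob (supp N \<mu>) = 1" using ev by (simp add: prob_eq_1)
  then show ?thesis using fin sing by unfold_locales auto
qed

lemma sum_Collect_Times:
  assumes "\<And>z. z \<in> S \<times> T \<Longrightarrow> Q z \<longleftrightarrow> A (fst z) \<and> B (snd z)"
  shows "(\<Sum>z | z \<in> S \<times> T \<and> Q z. f z) = (\<Sum>x | x \<in> S \<and> A x. \<Sum>y | y \<in> T \<and> B y. f (x, y))"
proof -
  have "{z. z \<in> S \<times> T \<and> Q z} = {x. x \<in> S \<and> A x} \<times> {y. y \<in> T \<and> B y}"
    using assms by auto
  then show ?thesis by (simp add: sum.cartesian_product)
qed

locale finite_path_marginals =
  fixes N :: nat and \<mu> \<nu> :: "(nat \<Rightarrow> real) measure"
  assumes \<mu>: "\<mu> \<in> space (prob_algebra (path_space N))" and \<nu>: "\<nu> \<in> space (prob_algebra (path_space N))"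
    and finite_supp: "finite (supp N \<mu>)" "finite (supp N \<nu>)"
begin

abbreviation S where "S \<equiv> supp N \<mu>"
abbreviation T where "T \<equiv> supp N \<nu>"
abbreviation P where "P \<equiv> path_space N"

sublocale \<mu>: finitely_supported_prob \<mu> S
  using \<mu> finite_supp(1) by (rule finitely_supported_supp)

sublocale \<nu>: finitely_supported_prob \<nu> T
  using \<nu> finite_supp(2) by (rule finitely_supported_supp)

lemma sets_marginals: "sets \<mu> = sets P" "sets \<nu> = sets P"
  using \<mu> \<nu> by (auto simp: space_prob_algebra)

lemma supp_nonempty: "S \<noteq> {}" "T \<noteq> {}"
  using \<mu>.prob_support \<nu>.prob_support by auto

lemma singleton_pair_sets: "z \<in> S \<times> T \<Longrightarrow> {z} \<in> sets (P \<Otimes>\<^sub>M P)"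
  using \<mu>.singleton_events \<nu>.singleton_events pair_measureI[of "{fst z}" P "{snd z}" P]
  by (auto simp: sets_marginals)

text \<open>Each coordinate lies almost surely in the support of its marginal; pulling both
  statements back along the projections confines the coupling to the grid.\<close>

lemma finitely_supported_coupling:
  assumes "\<pi> \<in> couplings N \<mu> \<nu>"
  shows "finitely_supported_prob \<pi> (S \<times> T)"
proof -
  have "prob_space \<pi>" and sets[measurable_cong]: "sets \<pi> = sets (P \<Otimes>\<^sub>M P)"
    and fst: "distr \<pi> P fst = \<mu>" and snd: "distr \<pi> P snd = \<nu>"
    using assms unfolding couplings_def space_prob_algebra by blast+
  interpret prob_space \<pi> by fact
  have "AE z in \<pi>. fst z \<in> S"
    by (rule AE_distrD[of _ _ P]) (measurable, simp only: fst \<mu>.AE_support)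
  moreover have "AE z in \<pi>. snd z \<in> T"
    by (rule AE_distrD[of _ _ P]) (measurable, simp only: snd \<nu>.AE_support)
  ultimately have AE: "AE z in \<pi>. z \<in> S \<times> T"
    by eventually_elim auto
  have "S \<times> T \<in> events"
    using \<mu>.support_events \<nu>.support_events by (simp add: sets sets_marginals)
  with AE have "prob (S \<times> T) = 1" by (simp add: prob_eq_1)
  then show ?thesis
    using finite_supp singleton_pair_sets by unfold_locales (auto simp: sets)
qed

section \<open>Marginal and causality conditions for a measure on the grid\<close>

context
  fixes \<pi> :: "((nat \<Rightarrow> real) \<times> (nat \<Rightarrow> real)) measure"
  assumes fs: "finitely_supported_prob \<pi> (S \<times> T)" and sets_\<pi>[measurable_cong]: "sets \<pi> = sets (P \<Otimes>\<^sub>M P)"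
begin

interpretation \<pi>: finitely_supported_prob \<pi> "S \<times> T" by (rule fs)

lemma measure_distr_coordinates:
  "x \<in> S \<Longrightarrow> measure (distr \<pi> P fst) {x} = (\<Sum>y\<in>T. measure \<pi> {(x, y)})"
  "y \<in> T \<Longrightarrow> measure (distr \<pi> P snd) {y} = (\<Sum>x\<in>S. measure \<pi> {(x, y)})"
proof -
  assume x: "x \<in> S"
  then have "{a. a \<in> S \<times> T \<and> fst a = x} = Pair x ` T" by auto
  then show "measure (distr \<pi> P fst) {x} = (\<Sum>y\<in>T. measure \<pi> {(x, y)})"
    using \<mu>.singleton_events[OF x]
    by (subst \<pi>.measure_distr_singleton) (auto simp: sets_marginals sum.reindex inj_on_def)
next
  assume y: "y \<in> T"
  then have "{a. a \<in> S \<times> T \<and> snd a = y} = (\<lambda>x. (x, y)) ` S" by auto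
  then show "measure (distr \<pi> P snd) {y} = (\<Sum>x\<in>S. measure \<pi> {(x, y)})"
    using \<nu>.singleton_events[OF y]
    by (subst \<pi>.measure_distr_singleton) (auto simp: sets_marginals sum.reindex inj_on_def)
qed

text \<open>The measure is not presupposed to be a coupling, so the criterion also applies to one
  built from weights. Its marginals are carried by \<open>S\<close> and \<open>T\<close> and are
  thus determined by row and column sums.\<close>

lemma couplings_iff:
  "\<pi> \<in> couplings N \<mu> \<nu> \<longleftrightarrow>
    (\<forall>y\<in>T. (\<Sum>x\<in>S. measure \<pi> {(x, y)}) = measure \<nu> {y}) \<and>
    (\<forall>x\<in>S. (\<Sum>y\<in>T. measure \<pi> {(x, y)}) = measure \<mu> {x})"
proof -
  have "finitely_supported_prob (distr \<pi> P fst) (fst ` (S \<times> T))"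
    using \<mu>.singleton_events by (intro \<pi>.finitely_supported_distr) (auto simp: sets_marginals)
  \<comment> \<open>The projection of \<open>S \<times> T\<close> is all of \<open>S\<close> because
    \<open>T\<close> is nonempty, having full mass under \<nu>.\<close>
  then have 1: "finitely_supported_prob (distr \<pi> P fst) S"
    using supp_nonempty by simp
  have "finitely_supported_prob (distr \<pi> P snd) (snd ` (S \<times> T))"
    using \<nu>.singleton_events by (intro \<pi>.finitely_supported_distr) (auto simp: sets_marginals)
  then have 2: "finitely_supported_prob (distr \<pi> P snd) T"
    using supp_nonempty by simp
  have "distr \<pi> P fst = \<mu> \<longleftrightarrow> (\<forall>x\<in>S. (\<Sum>y\<in>T. measure \<pi> {(x, y)}) = measure \<mu> {x})"
    using finitely_supported_prob_eqI[OF 1 \<mu>.finitely_supported_prob_axioms] measure_distr_coordinates(1)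
    by (auto simp: sets_marginals)
  moreover have "distr \<pi> P snd = \<nu> \<longleftrightarrow> (\<forall>y\<in>T. (\<Sum>x\<in>S. measure \<pi> {(x, y)}) = measure \<nu> {y})"
    using finitely_supported_prob_eqI[OF 2 \<nu>.finitely_supported_prob_axioms] measure_distr_coordinates(2)
    by (auto simp: sets_marginals)
  ultimately show ?thesis
    using \<pi>.prob_space_axioms sets_\<pi> by (auto simp: couplings_def space_prob_algebra)
qed

text \<open>The coupling hypothesis turns the quadratic atomic identities into linear ones, with
  coefficients that depend only on \<mu>. The value \<open>u\<close> may range independently of the
  prefix \<open>z\<close>: if no point of \<open>S\<close> has both, the sums over such points are
  empty and the identity reads \<open>0 = 0\<close>.\<close>

lemma cond_indep_given_coupling_iff:
  assumes \<pi>: "\<pi> \<in> couplings N \<mu> \<nu>" and t: "t \<in> {1..N-1}"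
  shows "cond_indep_given \<pi> borel (\<lambda>(x, y). x (t + 1)) (path_space t) (\<lambda>(x, y). restrict y {1..t})
      (path_space t) (\<lambda>(x, y). restrict x {1..t}) \<longleftrightarrow>
    (\<forall>z\<in>(\<lambda>x. restrict x {1..t}) ` S. \<forall>u\<in>(\<lambda>x. x (t + 1)) ` S. \<forall>v\<in>(\<lambda>y. restrict y {1..t}) ` T.
       (\<Sum>x | x \<in> S \<and> restrict x {1..t} = z. measure \<mu> {x})
       * (\<Sum>x | x \<in> S \<and> restrict x {1..t} = z \<and> x (t + 1) = u.
            \<Sum>y | y \<in> T \<and> restrict y {1..t} = v. measure \<pi> {(x, y)})
       = (\<Sum>x | x \<in> S \<and> restrict x {1..t} = z \<and> x (t + 1) = u. measure \<mu> {x})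
       * (\<Sum>x | x \<in> S \<and> restrict x {1..t} = z.
            \<Sum>y | y \<in> T \<and> restrict y {1..t} = v. measure \<pi> {(x, y)}))"
proof -
  define X :: "(nat \<Rightarrow> real) \<times> (nat \<Rightarrow> real) \<Rightarrow> real" where "X = (\<lambda>(x, y). x (t + 1))"
  define Y Z :: "(nat \<Rightarrow> real) \<times> (nat \<Rightarrow> real) \<Rightarrow> nat \<Rightarrow> real"
    where "Y = (\<lambda>(x, y). restrict y {1..t})" and "Z = (\<lambda>(x, y). restrict x {1..t})"
  have coord: "(\<lambda>x. x (t + 1)) \<in> borel_measurable P"
    unfolding path_space_def using t by (intro measurable_component_singleton) auto
  have pre: "(\<lambda>x. restrict x {1..t}) \<in> measurable P (path_space t)"
    unfolding path_space_def using t by (intro measurable_restrict_subset) auto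
  have X: "X \<in> borel_measurable \<pi>"
    unfolding X_def case_prod_beta by (rule measurable_compose[OF _ coord]) measurable
  have Y: "Y \<in> measurable \<pi> (path_space t)"
    unfolding Y_def case_prod_beta by (rule measurable_compose[OF _ pre]) measurable
  have Z: "Z \<in> measurable \<pi> (path_space t)"
    unfolding Z_def case_prod_beta by (rule measurable_compose[OF _ pre]) measurable
  have sing: "{restrict x {1..t}} \<in> sets (path_space t)" for x :: "nat \<Rightarrow> real"
    by (rule sets_path_space_singleton) auto
  have img: "X ` (S \<times> T) = (\<lambda>x. x (t + 1)) ` S" "Y ` (S \<times> T) = (\<lambda>y. restrict y {1..t}) ` T"
    "Z ` (S \<times> T) = (\<lambda>x. restrict x {1..t}) ` S"
    using supp_nonempty by (auto simp: X_def Y_def Z_def image_iff)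
  have row: "(\<Sum>y\<in>T. measure \<pi> {(x, y)}) = measure \<mu> {x}" if "x \<in> S" for x
    using \<pi> that by (simp add: couplings_iff)
  \<comment> \<open>Without a condition on \<open>y\<close> the inner sum is a full row, which the
    marginal constraint replaces by the weight of \<mu>.\<close>
  have sZ: "(\<Sum>a | a \<in> S \<times> T \<and> Z a = z. measure \<pi> {a}) =
      (\<Sum>x | x \<in> S \<and> restrict x {1..t} = z. measure \<mu> {x})" for z
    by (subst sum_Collect_Times[where A = "\<lambda>x. restrict x {1..t} = z" and B = "\<lambda>_. True"]) (auto simp: Z_def row intro!: sum.cong)
  have sZX: "(\<Sum>a | a \<in> S \<times> T \<and> Z a = z \<and> X a = u. measure \<pi> {a}) =
      (\<Sum>x | x \<in> S \<and> restrict x {1..t} = z \<and> x (t + 1) = u. measure \<mu> {x})" for z u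
    by (subst sum_Collect_Times[where A = "\<lambda>x. restrict x {1..t} = z \<and> x (t + 1) = u" and B = "\<lambda>_. True"])
      (auto simp: Z_def X_def row intro!: sum.cong)
  have sZY: "(\<Sum>a | a \<in> S \<times> T \<and> Z a = z \<and> Y a = v. measure \<pi> {a}) =
      (\<Sum>x | x \<in> S \<and> restrict x {1..t} = z. \<Sum>y | y \<in> T \<and> restrict y {1..t} = v. measure \<pi> {(x, y)})" for z v
    by (rule sum_Collect_Times) (auto simp: Z_def Y_def)
  have sZXY: "(\<Sum>a | a \<in> S \<times> T \<and> Z a = z \<and> X a = u \<and> Y a = v. measure \<pi> {a}) =
      (\<Sum>x | x \<in> S \<and> restrict x {1..t} = z \<and> x (t + 1) = u.
         \<Sum>y | y \<in> T \<and> restrict y {1..t} = v. measure \<pi> {(x, y)})" for z u v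
    by (rule sum_Collect_Times) (auto simp: Z_def X_def Y_def)
  have "cond_indep_given \<pi> borel X (path_space t) Y (path_space t) Z \<longleftrightarrow>
    (\<forall>z\<in>Z ` (S \<times> T). \<forall>u\<in>X ` (S \<times> T). \<forall>v\<in>Y ` (S \<times> T).
      (\<Sum>a | a \<in> S \<times> T \<and> Z a = z. measure \<pi> {a}) * (\<Sum>a | a \<in> S \<times> T \<and> Z a = z \<and> X a = u \<and> Y a = v. measure \<pi> {a})
      = (\<Sum>a | a \<in> S \<times> T \<and> Z a = z \<and> X a = u. measure \<pi> {a}) * (\<Sum>a | a \<in> S \<times> T \<and> Z a = z \<and> Y a = v. measure \<pi> {a}))"
    using sing by (intro \<pi>.cond_indep_given_iff X Y Z) (auto simp: Y_def Z_def)
  then show ?thesis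
    unfolding sZ sZX sZY sZXY img unfolding X_def Y_def Z_def .
qed

end

text \<open>The enumerations matter only through their ranges: quantifying over indices is
  quantifying over the prefixes and values that occur. The bounds on the weights hold for every
  probability measure.\<close>

lemma weights_feasible_iff:
  assumes fs: "finitely_supported_prob \<pi> (S \<times> T)" and sets: "sets \<pi> = sets (P \<Otimes>\<^sub>M P)"
    and xpre: "\<And>t. t \<in> {1..N} \<Longrightarrow> bij_betw (xpre t) {1..nxpre t} ((\<lambda>x. restrict x {1..t}) ` S)"
    and xcur: "\<And>t. t \<in> {1..N} \<Longrightarrow> bij_betw (xcur t) {1..nxcur t} ((\<lambda>x. x t) ` S)"
    and ypre: "\<And>t. t \<in> {1..N} \<Longrightarrow> bij_betw (ypre t) {1..mypre t} ((\<lambda>y. restrict y {1..t}) ` T)"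
  shows "weights S T \<pi> \<in> lp_feasible N \<mu> \<nu> nxpre xpre nxcur xcur mypre ypre \<longleftrightarrow> \<pi> \<in> causal_couplings N \<mu> \<nu>"
proof -
  interpret \<pi>: finitely_supported_prob \<pi> "S \<times> T" by (rule fs)
  define w where "w = weights S T \<pi>"
  have w: "w (x, y) = measure \<pi> {(x, y)}" if "x \<in> S" "y \<in> T" for x y
    using that by (simp add: w_def weights_def)
  define causal where "causal t z u v \<longleftrightarrow>
       (\<Sum>x | x \<in> S \<and> restrict x {1..t} = z. measure \<mu> {x})
       * (\<Sum>x | x \<in> S \<and> restrict x {1..t} = z \<and> x (t + 1) = u.
            \<Sum>y | y \<in> T \<and> restrict y {1..t} = v. w (x, y))
       = (\<Sum>x | x \<in> S \<and> restrict x {1..t} = z \<and> x (t + 1) = u. measure \<mu> {x})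
       * (\<Sum>x | x \<in> S \<and> restrict x {1..t} = z.
            \<Sum>y | y \<in> T \<and> restrict y {1..t} = v. w (x, y))" for t z u v
  have couplings: "\<pi> \<in> couplings N \<mu> \<nu> \<longleftrightarrow>
      (\<forall>y\<in>T. (\<Sum>x\<in>S. w (x, y)) = measure \<nu> {y}) \<and> (\<forall>x\<in>S. (\<Sum>y\<in>T. w (x, y)) = measure \<mu> {x})"
    unfolding couplings_iff[OF fs sets] by (simp add: w cong: sum.cong)
  have causal: "cond_indep_given \<pi> borel (\<lambda>(x, y). x (t + 1)) (path_space t) (\<lambda>(x, y). restrict y {1..t})
      (path_space t) (\<lambda>(x, y). restrict x {1..t}) \<longleftrightarrow>
      (\<forall>i\<in>{1..nxpre t}. \<forall>j\<in>{1..mypre t}. \<forall>k\<in>{1..nxcur (t + 1)}.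
         causal t (xpre t i) (xcur (t + 1) k) (ypre t j))"
    if \<pi>: "\<pi> \<in> couplings N \<mu> \<nu>" and t: "t \<in> {1..N-1}" for t
  proof -
    have inner: "(\<Sum>x | x \<in> S \<and> Q x. \<Sum>y | y \<in> T \<and> R y. measure \<pi> {(x, y)}) =
        (\<Sum>x | x \<in> S \<and> Q x. \<Sum>y | y \<in> T \<and> R y. w (x, y))" for Q R
      by (intro sum.cong refl) (simp add: w)
    \<comment> \<open>The upper limit \<open>N - 1\<close> for \<open>t\<close> keeps
      \<open>t + 1\<close> within the range where \<open>xcur\<close> is an enumeration.\<close>
    have t': "t \<in> {1..N}" "t + 1 \<in> {1..N}" using t by auto
    have "xpre t ` {1..nxpre t} = (\<lambda>x. restrict x {1..t}) ` S"
      "xcur (t + 1) ` {1..nxcur (t + 1)} = (\<lambda>x. x (t + 1)) ` S"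
      "ypre t ` {1..mypre t} = (\<lambda>y. restrict y {1..t}) ` T"
      by (intro bij_betw_imp_surj_on xpre xcur ypre t')+
    note enum = this[symmetric]
    show ?thesis
      unfolding cond_indep_given_coupling_iff[OF fs sets \<pi> t] inner causal_def[symmetric] enum
      by blast
  qed
  have "w \<in> extensional (S \<times> T)"
    by (simp add: w_def weights_def)
  moreover have "\<forall>x\<in>S. \<forall>y\<in>T. w (x, y) \<in> {0..1}"
    using w by simp
  ultimately have "w \<in> lp_feasible N \<mu> \<nu> nxpre xpre nxcur xcur mypre ypre \<longleftrightarrow> \<pi> \<in> couplings N \<mu> \<nu> \<and>
      (\<forall>t\<in>{1..N-1}. \<forall>i\<in>{1..nxpre t}. \<forall>j\<in>{1..mypre t}. \<forall>k\<in>{1..nxcur (t + 1)}.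
         causal t (xpre t i) (xcur (t + 1) k) (ypre t j))"
    unfolding lp_feasible_def Let_def couplings causal_def by simp
  \<comment> \<open>\<open>causal\<close> is available only for couplings; this suffices because
    both sides contain the coupling condition as a conjunct.\<close>
  also have "\<dots> \<longleftrightarrow> \<pi> \<in> causal_couplings N \<mu> \<nu>"
    unfolding causal_couplings_def using causal by auto
  finally show ?thesis unfolding w_def .
qed

text \<open>Injectivity holds because atoms determine a measure on the grid. For surjectivity, a
  measure realising given feasible weights is constructed, and the feasibility equivalence, read
  backwards, certifies that it is a causal coupling.\<close>

lemma bij_betw_weights:
  assumes xpre: "\<And>t. t \<in> {1..N} \<Longrightarrow> bij_betw (xpre t) {1..nxpre t} ((\<lambda>x. restrict x {1..t}) ` S)"
    and xcur: "\<And>t. t \<in> {1..N} \<Longrightarrow> bij_betw (xcur t) {1..nxcur t} ((\<lambda>x. x t) ` S)"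
    and ypre: "\<And>t. t \<in> {1..N} \<Longrightarrow> bij_betw (ypre t) {1..mypre t} ((\<lambda>y. restrict y {1..t}) ` T)"
  shows "bij_betw (weights S T) (causal_couplings N \<mu> \<nu>) (lp_feasible N \<mu> \<nu> nxpre xpre nxcur xcur mypre ypre)"
    (is "bij_betw ?W ?C ?F")
proof -
  note iff = weights_feasible_iff[OF _ _ xpre xcur ypre]
  have C: "finitely_supported_prob \<pi> (S \<times> T)" "sets \<pi> = sets (P \<Otimes>\<^sub>M P)" if "\<pi> \<in> ?C" for \<pi>
  proof -
    have \<pi>: "\<pi> \<in> couplings N \<mu> \<nu>" using that unfolding causal_couplings_def by blast
    then show "finitely_supported_prob \<pi> (S \<times> T)" by (rule finitely_supported_coupling)
    show "sets \<pi> = sets (P \<Otimes>\<^sub>M P)" using \<pi> unfolding couplings_def space_prob_algebra by blast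
  qed
  have "inj_on ?W ?C"
  proof (rule inj_onI)
    fix \<pi> \<pi>'
    assume \<pi>: "\<pi> \<in> ?C" "\<pi>' \<in> ?C" and eq: "?W \<pi> = ?W \<pi>'"
    have "measure \<pi> {z} = measure \<pi>' {z}" if "z \<in> S \<times> T" for z
      using fun_cong[OF eq, of z] that unfolding weights_def by (simp only: restrict_apply' if_True)
    then show "\<pi> = \<pi>'"
      using C[OF \<pi>(1)] C[OF \<pi>(2)] by (intro finitely_supported_prob_eqI[of \<pi> "S \<times> T" \<pi>']) simp_all
  qed
  moreover have "?W ` ?C = ?F"
  proof (intro equalityI subsetI)
    fix w
    assume "w \<in> ?W ` ?C"
    then show "w \<in> ?F" using iff[OF C] by blast
  next
    fix w
    assume w: "w \<in> ?F"
    then have ext: "w \<in> extensional (S \<times> T)" and nonneg: "\<And>z. z \<in> S \<times> T \<Longrightarrow> w z \<ge> 0"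
      and cols: "\<And>y. y \<in> T \<Longrightarrow> (\<Sum>x\<in>S. w (x, y)) = measure \<nu> {y}"
      by (auto simp: lp_feasible_def Let_def)
    \<comment> \<open>Total mass one is not a constraint of the program; it follows because the
      column sums are the weights of \<nu>.\<close>
    have "(\<Sum>z\<in>S \<times> T. w z) = (\<Sum>x\<in>S. \<Sum>y\<in>T. w (x, y))"
      by (simp add: sum.cartesian_product)
    also have "\<dots> = (\<Sum>y\<in>T. \<Sum>x\<in>S. w (x, y))"
      by (rule sum.swap)
    also have "\<dots> = (\<Sum>y\<in>T. measure \<nu> {y})"
      using cols by (rule sum.cong[OF refl])
    finally have "(\<Sum>z\<in>S \<times> T. w z) = 1"
      by (simp only: \<nu>.sum_prob_support)
    then obtain \<pi> where \<pi>: "sets \<pi> = sets (P \<Otimes>\<^sub>M P)" "finitely_supported_prob \<pi> (S \<times> T)"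
        "\<And>z. z \<in> S \<times> T \<Longrightarrow> measure \<pi> {z} = w z"
      using finite_supp singleton_pair_sets nonneg
      by (elim finitely_supported_prob_exists[rotated 3]) auto
    have "?W \<pi> = w"
      unfolding weights_def using \<pi>(3) ext by (intro extensionalityI[of _ "S \<times> T"]) simp_all
    then show "w \<in> ?W ` ?C"
      using iff[OF \<pi>(2,1)] w by blast
  qed
  ultimately show ?thesis by (simp add: bij_betw_def)
qed

text \<open>These are the weights of the independent coupling. Double sums split into a \<mu>-sum
  times a \<nu>-sum, so both sides of a causal constraint are the same three factors in different
  order.\<close>

lemma product_weights_feasible:
  "(\<lambda>(x, y)\<in>S \<times> T. measure \<mu> {x} * measure \<nu> {y}) \<in> lp_feasible N \<mu> \<nu> nxpre xpre nxcur xcur mypre ypre"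
    (is "?w \<in> _")
proof -
  have inner: "(\<Sum>x | x \<in> S \<and> Q x. \<Sum>y | y \<in> T \<and> R y. ?w (x, y)) =
      (\<Sum>x | x \<in> S \<and> Q x. measure \<mu> {x}) * (\<Sum>y | y \<in> T \<and> R y. measure \<nu> {y})" for Q R
    unfolding sum_product by (intro sum.cong refl) simp
  have cols: "(\<Sum>x\<in>S. ?w (x, y)) = measure \<nu> {y}" if "y \<in> T" for y
    using that \<mu>.sum_prob_support by (simp add: sum_distrib_right[symmetric])
  have rows: "(\<Sum>y\<in>T. ?w (x, y)) = measure \<mu> {x}" if "x \<in> S" for x
    using that \<nu>.sum_prob_support by (simp add: sum_distrib_left[symmetric])
  have bounds: "?w (x, y) \<in> {0..1}" if "x \<in> S" "y \<in> T" for x y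
    using that by (simp add: mult_le_one)
  have causal: "(\<Sum>x | x \<in> S \<and> Q x. measure \<mu> {x}) * (\<Sum>x | x \<in> S \<and> Q' x. \<Sum>y | y \<in> T \<and> R y. ?w (x, y)) =
      (\<Sum>x | x \<in> S \<and> Q' x. measure \<mu> {x}) * (\<Sum>x | x \<in> S \<and> Q x. \<Sum>y | y \<in> T \<and> R y. ?w (x, y))" for Q Q' R
    unfolding inner by (rule mult.left_commute)
  show ?thesis
    unfolding lp_feasible_def Let_def
    by (intro CollectI conjI ballI restrict_extensional cols rows bounds causal; assumption)
qed

lemma
  assumes c: "c \<in> borel_measurable (P \<Otimes>\<^sub>M P)" and \<pi>: "\<pi> \<in> couplings N \<mu> \<nu>"
  shows integrable_coupling: "integrable \<pi> c"
    and integral_coupling: "(\<integral>z. c z \<partial>\<pi>) = lp_objective S T c (weights S T \<pi>)"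
proof -
  interpret \<pi>: finitely_supported_prob \<pi> "S \<times> T"
    using \<pi> by (rule finitely_supported_coupling)
  have "sets \<pi> = sets (P \<Otimes>\<^sub>M P)" using \<pi> unfolding couplings_def space_prob_algebra by blast
  then have c': "c \<in> borel_measurable \<pi>" using c measurable_cong_sets by blast
  then show "integrable \<pi> c" by (rule \<pi>.integrable_support)
  have "(\<integral>z. c z \<partial>\<pi>) = (\<Sum>x\<in>S. \<Sum>y\<in>T. c (x, y) * measure \<pi> {(x, y)})"
    using \<pi>.integral_support[OF c'] by (simp add: sum.cartesian_product case_prod_beta)
  also have "\<dots> = lp_objective S T c (weights S T \<pi>)"
    unfolding lp_objective_def weights_def by (intro sum.cong refl) simp
  finally show "(\<integral>z. c z \<partial>\<pi>) = lp_objective S T c (weights S T \<pi>)" .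
qed

end

section \<open>The linear program\<close>

lemma continuous_on_sum_coordinates:
  "continuous_on UNIV (\<lambda>w :: 'i \<Rightarrow> real. \<Sum>x\<in>A. \<Sum>y\<in>B. a x y * w (f x y))"
  by (intro continuous_on_sum continuous_on_mult continuous_on_const continuous_on_product_coordinates)

lemma closed_Collect_Ball: "(\<And>a. closed {w. Q a w}) \<Longrightarrow> closed {w. \<forall>a\<in>A. Q a w}"
  by (simp add: Collect_ball_eq closed_INT)

text \<open>Weights are total functions on the whole type of pairs, under the topology of pointwise
  convergence. Compactness of the box is Tychonoff's theorem, and the equality constraints are
  continuous in the coordinates, so they cut out a closed set.\<close>

lemma compact_lp_feasible: "compact (lp_feasible N \<mu> \<nu> nxpre xpre nxcur xcur mypre ypre)"
proof -
  define S T where "S = supp N \<mu>" and "T = supp N \<nu>"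
  \<comment> \<open>Off the grid the factor is the single point \<open>undefined\<close>, so the
    product of the \<open>K z\<close> is exactly the set of extensional functions with values in
    \<open>{0..1}\<close> on the grid.\<close>
  define K where "K z = (if z \<in> S \<times> T then {0..1} else {undefined :: real})" for z
  have "compactin (product_topology (\<lambda>_. euclideanreal) UNIV) (Pi\<^sub>E UNIV K)"
    unfolding compactin_PiE by (auto simp: K_def)
  then have cpt: "compact (Pi\<^sub>E UNIV K)"
    by (simp add: euclidean_product_topology)
  define L where "L = {w. (\<forall>y\<in>T. (\<Sum>x\<in>S. w (x, y)) = measure \<nu> {y}) \<and>
        (\<forall>x\<in>S. (\<Sum>y\<in>T. w (x, y)) = measure \<mu> {x}) \<and>
        (\<forall>t\<in>{1..N-1}. \<forall>i\<in>{1..nxpre t}. \<forall>j\<in>{1..mypre t}. \<forall>k\<in>{1..nxcur (t + 1)}.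
           (\<Sum>x | x \<in> S \<and> restrict x {1..t} = xpre t i. measure \<mu> {x})
           * (\<Sum>x | x \<in> S \<and> restrict x {1..t} = xpre t i \<and> x (t + 1) = xcur (t + 1) k.
                \<Sum>y | y \<in> T \<and> restrict y {1..t} = ypre t j. w (x, y))
           = (\<Sum>x | x \<in> S \<and> restrict x {1..t} = xpre t i \<and> x (t + 1) = xcur (t + 1) k. measure \<mu> {x})
           * (\<Sum>x | x \<in> S \<and> restrict x {1..t} = xpre t i.
                \<Sum>y | y \<in> T \<and> restrict y {1..t} = ypre t j. w (x, y)))}"
  have "closed L"
    unfolding L_def
    by (intro closed_Collect_conj closed_Collect_Ball closed_Collect_eq continuous_on_sum
        continuous_on_mult continuous_on_const continuous_on_product_coordinates)
  with cpt have "compact (Pi\<^sub>E UNIV K \<inter> L)"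
    by (rule compact_Int_closed)
  also have "Pi\<^sub>E UNIV K = {w \<in> extensional (S \<times> T). \<forall>x\<in>S. \<forall>y\<in>T. w (x, y) \<in> {0..1}}"
    by (auto simp: K_def PiE_iff extensional_def split: if_splits)
  also have "\<dots> \<inter> L = lp_feasible N \<mu> \<nu> nxpre xpre nxcur xcur mypre ypre"
    unfolding L_def lp_feasible_def Let_def S_def T_def by blast
  finally show ?thesis .
qed

text \<open>Optimality compares a point with its competitors only through their costs, and
  \<open>W\<close> carries the competitors in \<open>C\<close> onto those in \<open>F\<close> with
  equal costs.\<close>

lemma is_arg_min_bij_betw:
  assumes "bij_betw W C F" "\<And>\<pi>. \<pi> \<in> C \<Longrightarrow> cost \<pi> = obj (W \<pi>)" "\<pi> \<in> C"
  shows "is_arg_min cost (\<lambda>\<pi>. \<pi> \<in> C) \<pi> \<longleftrightarrow> is_arg_min obj (\<lambda>w. w \<in> F) (W \<pi>)"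
proof -
  have "F = W ` C" using assms(1) by (simp add: bij_betw_def)
  then show ?thesis using assms(2,3) by (auto simp: is_arg_min_def)
qed

text \<open>The identification of couplings with weights is expressed by the bijection together with
  equality of the objectives. An attained minimum also ensures that the final equation compares
  genuine infima rather than default values of \<open>INF\<close> on the reals.\<close>

theorem lemma3p11:
  fixes N :: nat
    and \<mu> \<nu> :: "(nat \<Rightarrow> real) measure"
    and c :: "(nat \<Rightarrow> real) \<times> (nat \<Rightarrow> real) \<Rightarrow> real"
    and nxpre nxcur mypre :: "nat \<Rightarrow> nat"
    and xpre ypre :: "nat \<Rightarrow> nat \<Rightarrow> nat \<Rightarrow> real"
    and xcur :: "nat \<Rightarrow> nat \<Rightarrow> real"
  assumes "N \<ge> 1"
    and "\<mu> \<in> space (prob_algebra (path_space N))"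
    and "\<nu> \<in> space (prob_algebra (path_space N))"
    and "finite (supp N \<mu>)" and "finite (supp N \<nu>)"
    and "continuous_map (prod_topology (path_topology N) (path_topology N)) euclideanreal c"
    and "\<And>t. t \<in> {1..N} \<Longrightarrow>
           bij_betw (xpre t) {1..nxpre t} ((\<lambda>x. restrict x {1..t}) ` supp N \<mu>)"
    and "\<And>t. t \<in> {1..N} \<Longrightarrow>
           bij_betw (xcur t) {1..nxcur t} ((\<lambda>x. x t) ` supp N \<mu>)"
    and "\<And>t. t \<in> {1..N} \<Longrightarrow>
           bij_betw (ypre t) {1..mypre t} ((\<lambda>y. restrict y {1..t}) ` supp N \<nu>)"
  shows "let W = weights (supp N \<mu>) (supp N \<nu>);
             C = causal_couplings N \<mu> \<nu>;
             cost = (\<lambda>\<pi>. \<integral>z. c z \<partial>\<pi>);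
             F = lp_feasible N \<mu> \<nu> nxpre xpre nxcur xcur mypre ypre;
             obj = lp_objective (supp N \<mu>) (supp N \<nu>) c
         in bij_betw W C F
          \<and> (\<forall>\<pi>\<in>C. integrable \<pi> c \<and> cost \<pi> = obj (W \<pi>))
          \<and> (\<exists>\<pi>. is_arg_min cost (\<lambda>\<pi>. \<pi> \<in> C) \<pi>)
          \<and> (\<forall>\<pi>\<in>C. is_arg_min cost (\<lambda>\<pi>. \<pi> \<in> C) \<pi> \<longleftrightarrow> is_arg_min obj (\<lambda>w. w \<in> F) (W \<pi>))
          \<and> (INF \<pi>\<in>C. cost \<pi>) = (INF w\<in>F. obj w)"
proof -
  interpret finite_path_marginals N \<mu> \<nu>
    using assms(2-5) by unfold_locales
  define W C F where "W = weights S T" and "C = causal_couplings N \<mu> \<nu>"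
    and "F = lp_feasible N \<mu> \<nu> nxpre xpre nxcur xcur mypre ypre"
  define cost where "cost = (\<lambda>\<pi>. \<integral>z. c z \<partial>\<pi>)"
  define obj where "obj = lp_objective S T c"
  have bij: "bij_betw W C F"
    unfolding W_def C_def F_def using assms(7-9) by (rule bij_betw_weights)
  have coupling: "\<pi> \<in> couplings N \<mu> \<nu>" if "\<pi> \<in> C" for \<pi>
    using that unfolding C_def causal_couplings_def by blast
  note c = continuous_map_path_measurable[OF assms(6)]
  have integrable: "integrable \<pi> c" if "\<pi> \<in> C" for \<pi>
    using c coupling[OF that] by (rule integrable_coupling)
  have cost: "cost \<pi> = obj (W \<pi>)" if "\<pi> \<in> C" for \<pi>
    unfolding cost_def obj_def W_def using c coupling[OF that] by (rule integral_coupling)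
  have argmin: "is_arg_min cost (\<lambda>\<pi>. \<pi> \<in> C) \<pi> \<longleftrightarrow> is_arg_min obj (\<lambda>w. w \<in> F) (W \<pi>)" if "\<pi> \<in> C" for \<pi>
    by (rule is_arg_min_bij_betw[where cost = cost and obj = obj, OF bij cost that])
  have "continuous_on F obj"
    unfolding obj_def lp_objective_def
    by (rule continuous_on_subset[OF continuous_on_sum_coordinates subset_UNIV])
  moreover have "F \<noteq> {}"
    unfolding F_def using product_weights_feasible by blast
  moreover have "compact F"
    unfolding F_def by (rule compact_lp_feasible)
  ultimately obtain w where w: "w \<in> F" "\<And>w'. w' \<in> F \<Longrightarrow> obj w \<le> obj w'"
    using continuous_attains_inf by metis
  obtain \<pi> where \<pi>: "\<pi> \<in> C" "W \<pi> = w"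
    using bij w(1) by (metis bij_betw_def imageE)
  have "is_arg_min obj (\<lambda>w. w \<in> F) w"
    using w by (simp add: is_arg_min_linorder)
  then have ex: "\<exists>\<pi>. is_arg_min cost (\<lambda>\<pi>. \<pi> \<in> C) \<pi>"
    using argmin \<pi> by blast
  \<comment> \<open>The two problems have the same set of attained values, so their infima
    coincide.\<close>
  have "cost ` C = obj ` F"
    using bij cost unfolding bij_betw_def by (metis (no_types, lifting) image_cong image_image)
  then have inf: "(INF \<pi>\<in>C. cost \<pi>) = (INF w\<in>F. obj w)"
    by simp
  show ?thesis
    unfolding Let_def C_def[symmetric] W_def[symmetric] F_def[symmetric] cost_def[symmetric] obj_def[symmetric]
    using bij integrable cost argmin ex inf unfolding cost_def by blast
qed

end
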